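(* Let $C$ be a nonempty closed convex subset of a real Hilbert space $H$. Let $T:C\to C$ be an $L$-Lipschitz pseudo-contractive mapping such that $L\ge1$ and $F(T)\ne\emptyset$. Assume $\{\tau_n\}_{n\ge0}\subset[\tau,1]$ with $\tau\in(0,1]$ and $\{\alpha_n\}_{n\ge0}\subset[a,b]$ with $a,b\in(0,\frac1{L+1})$. Let $x_0\in C$ be arbitrary and let $\{x_n\}$ be given, for $n\ge0$, by $$y_n=(1-\alpha_n)x_n+\alpha_nTx_n,$$ $$C_n=\{z\in C:\tau_n\|\alpha_n(I-T)y_n\|^2\le2\alpha_n\langle x_n-z,(I-T)y_n\rangle\},$$ $$Q_n=\{z\in C:\langle z-x_n,x_n-x_0\rangle\ge0\},$$ $$x_{n+1}=P_{C_n^*\cap Q_n}x_0,$$ where $C_n^*$ is a closed convex set with $F(T)\subset C_n^*\subset C_n$. Then $\{x_n\}$ converges strongly to $P_{F(T)}x_0$.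
   Context: $F(T)=\{x\in C:Tx=x\}$; $I$ is the identity. $T$ is pseudo-contractive if $\|Tx-Ty\|^2\le\|x-y\|^2+\|(I-T)x-(I-T)y\|^2$ for all $x,y\in C$. $T$ is $L$-Lipschitz if $\|Tx-Ty\|\le L\|x-y\|$ for all $x,y\in C$. For a nonempty closed convex set $D\subset H$, $P_D$ is the metric projection (nearest-point map) onto $D$. *)

theory Defs
  imports "HOL-Analysis.Analysis"
begin

definition fixed_points :: "'a set \<Rightarrow> ('a \<Rightarrow> 'a) \<Rightarrow> 'a set" where
  "fixed_points C T = {x \<in> C. T x = x}"

definition pseudo_contractive_on :: "'a::real_inner set \<Rightarrow> ('a \<Rightarrow> 'a) \<Rightarrow> bool" where
  "pseudo_contractive_on C T \<longleftrightarrow>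
     (\<forall>x\<in>C. \<forall>y\<in>C. (norm (T x - T y))\<^sup>2
        \<le> (norm (x - y))\<^sup>2 + (norm ((x - T x) - (y - T y)))\<^sup>2)"

(* The library's closest_point is restricted to class heine_borel, i.e. to finite dimension.
   The nearest point exists and is unique when D is a nonempty closed convex subset of a
   Hilbert space; otherwise the value may be unspecified. *)
definition metric_proj :: "'a::metric_space set \<Rightarrow> 'a \<Rightarrow> 'a" where
  "metric_proj D x = (THE p. p \<in> D \<and> (\<forall>z\<in>D. dist x p \<le> dist x z))"

end

theory Submission
  imports Defs
begin

text \<open>
  Pseudo-contractivity of \<open>T\<close> says exactly that \<open>I - T\<close> is monotone
  (\<open>pseudo_contractive_on_iff_monotone\<close>). Minty's trick then describes the fixed points by
  inequalities that are affine in the unknown point (\<open>fixed_points_Minty\<close>), so \<open>F(T)\<close> is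
  closed and convex and its projection \<open>q\<close> of \<open>x\<^sub>0\<close> makes sense.

  By induction \<open>F(T)\<close> lies in every \<open>C\<^sub>n\<^sup>* \<inter> Q\<^sub>n\<close>: the variational inequality of the projection
  \<open>x\<^sub>n\<^sub>+\<^sub>1\<close> is the condition that defines \<open>Q\<^sub>n\<^sub>+\<^sub>1\<close>. Hence \<open>x\<^sub>n\<close> is never farther from \<open>x\<^sub>0\<close> than
  \<open>q\<close>. As \<open>x\<^sub>n\<^sub>+\<^sub>1 \<in> Q\<^sub>n\<close>, an obtuse angle at \<open>x\<^sub>n\<close> makes the distances to \<open>x\<^sub>0\<close> increase, by an
  amount that controls the step length, so the steps tend to \<open>0\<close>. As \<open>x\<^sub>n\<^sub>+\<^sub>1 \<in> C\<^sub>n\<close>, the step length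
  controls the residual \<open>(I - T) y\<^sub>n\<close>, and the bound \<open>(L + 1) b < 1\<close> transfers this control to
  \<open>(I - T) x\<^sub>n\<close>. Thus the \<open>x\<^sub>n\<close> are approximate fixed points.

  The remaining step is \<open>approximate_fixed_points_tendsto_proj\<close>: approximate fixed points in
  \<open>C\<close> that are no farther from \<open>x\<^sub>0\<close> than \<open>q\<close> converge to \<open>q\<close>. The usual argument passes to
  weak cluster points. Here they are replaced by a point common to the closed convex hulls of all
  tails of the sequence, found as the limit of the points of these hulls nearest to \<open>x\<^sub>0\<close>.
  Minty's inequalities pass to that point because each of them describes a closed half-space,
  which contains a whole hull as soon as it contains a tail. The point is therefore
  fixed and no farther than \<open>q\<close>, so it is \<open>q\<close>, and the Pythagorean inequality in the hulls
  makes the convergence strong.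
\<close>

section \<open>Nearest points in a complete inner product space\<close>

text \<open>
  Hilbert space arguments bound squared distances by gaps of a convergent real quantity; in this
  form the criterion serves minimizing sequences as well as projections onto shrinking sets.
\<close>

lemma Cauchy_if_dist_square_le:
  fixes p :: "nat \<Rightarrow> 'a::metric_space" and s :: "nat \<Rightarrow> real"
  assumes s: "s \<longlonglongrightarrow> 0" and le: "\<And>m k. m \<le> k \<Longrightarrow> (dist (p m) (p k))\<^sup>2 \<le> s m + s k"
  shows "Cauchy p"
  unfolding Cauchy_altdef
proof (intro allI impI)
  fix e :: real assume "e > 0"
  then have "e\<^sup>2 / 2 > 0" by simp
  from order_tendstoD(2)[OF s this]
  obtain M where M: "\<And>n. n \<ge> M \<Longrightarrow> s n < e\<^sup>2 / 2"
    unfolding eventually_sequentially by blast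
  have "dist (p m) (p n) < e" if "m \<ge> M" "n > m" for m n
  proof -
    have "(dist (p m) (p n))\<^sup>2 < e\<^sup>2"
      using le[of m n] M[of m] M[of n] that by simp
    then show ?thesis using \<open>e > 0\<close> by (simp add: power2_less_imp_less)
  qed
  then show "\<exists>M. \<forall>m\<ge>M. \<forall>n>m. dist (p m) (p n) < e" by blast
qed

text \<open>
  A minimizing sequence is Cauchy: by the parallelogram law two nearly optimal points that were
  far apart would have a midpoint, again in \<open>D\<close>, below the infimum.
\<close>

lemma nearest_point_exists:
  fixes D :: "'a::{real_inner, complete_space} set"
  assumes "closed D" "convex D" "D \<noteq> {}"
  shows "\<exists>p\<in>D. \<forall>z\<in>D. dist x p \<le> dist x z"
proof -
  define d where "d = (INF u\<in>D. (dist x u)\<^sup>2)"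
  have bdd: "bdd_below ((\<lambda>u. (dist x u)\<^sup>2) ` D)" by (rule bdd_belowI[of _ 0]) auto
  have d_le: "d \<le> (dist x z)\<^sup>2" if "z \<in> D" for z
    unfolding d_def using bdd that by (rule cINF_lower)
  have "\<exists>u\<in>D. (dist x u)\<^sup>2 < d + inverse (real (Suc n))" for n
  proof -
    have "(INF u\<in>D. (dist x u)\<^sup>2) < d + inverse (real (Suc n))" by (simp add: d_def)
    then show ?thesis using cINF_less_iff[OF \<open>D \<noteq> {}\<close> bdd] by blast
  qed
  then obtain u where u: "\<And>n. u n \<in> D" "\<And>n. (dist x (u n))\<^sup>2 < d + inverse (real (Suc n))"
    by metis
  define s where "s n = 2 * inverse (real (Suc n))" for n
  have "s \<longlonglongrightarrow> 2 * 0"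
    unfolding s_def by (intro tendsto_intros LIMSEQ_inverse_real_of_nat)
  then have s: "s \<longlonglongrightarrow> 0" by simp
  have "(dist (u m) (u k))\<^sup>2 \<le> s m + s k" for m k
  proof -
    (* the midpoint, whose squared distance to x is at least d *)
    let ?c = "(1/2) *\<^sub>R u m + (1/2) *\<^sub>R u k"
    have "?c \<in> D" using u(1) \<open>convex D\<close> by (intro convexD) auto
    have "(dist (u m) (u k))\<^sup>2 = 2 * (dist x (u m))\<^sup>2 + 2 * (dist x (u k))\<^sup>2 - 4 * (dist x ?c)\<^sup>2"
      by (simp add: dist_norm power2_norm_eq_inner algebra_simps inner_commute)
    then show ?thesis using d_le[OF \<open>?c \<in> D\<close>] u(2)[of m] u(2)[of k] by (simp add: s_def)
  qed
  then have "Cauchy u" by (rule Cauchy_if_dist_square_le[OF s])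
  then obtain p where p: "u \<longlonglongrightarrow> p" by (meson Cauchy_convergent convergent_def)
  have "p \<in> D" using closed_sequentially[OF \<open>closed D\<close>, of u p] u(1) p by blast
  moreover have "dist x p \<le> dist x z" if "z \<in> D" for z
  proof -
    have "(\<lambda>n. d + inverse (real (Suc n))) \<longlonglongrightarrow> d + 0"
      by (intro tendsto_intros LIMSEQ_inverse_real_of_nat)
    moreover have "(\<lambda>n. (dist x (u n))\<^sup>2) \<longlonglongrightarrow> (dist x p)\<^sup>2" by (intro tendsto_intros p)
    ultimately have "(dist x p)\<^sup>2 \<le> d + 0"
      by (rule tendsto_le[OF sequentially_bot]) (use u(2) less_imp_le in \<open>auto intro!: always_eventually\<close>)
    then show ?thesis using d_le[OF that] by (smt (verit) power2_le_imp_le zero_le_dist)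
  qed
  ultimately show ?thesis by blast
qed

lemma
  fixes D :: "'a::{real_inner, complete_space} set"
  assumes "closed D" "convex D" "D \<noteq> {}"
  shows metric_proj_in: "metric_proj D x \<in> D"
    and metric_proj_nearest: "z \<in> D \<Longrightarrow> dist x (metric_proj D x) \<le> dist x z"
proof -
  have "\<exists>!p. p \<in> D \<and> (\<forall>z\<in>D. dist x p \<le> dist x z)"
    using nearest_point_exists[OF assms, of x] any_closest_point_unique[OF assms(2,1), of _ _ x]
    by blast
  from theI'[OF this] show "metric_proj D x \<in> D"
    and "z \<in> D \<Longrightarrow> dist x (metric_proj D x) \<le> dist x z"
    unfolding metric_proj_def by blast+
qed

text \<open>
  Read as a condition on \<open>z\<close>, the inequality describes a half-space with the projection on its
  boundary; the sets \<open>Q\<^sub>n\<close> are cut from \<open>C\<close> by half-spaces of this form.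
\<close>

lemma metric_proj_variational:
  fixes D :: "'a::{real_inner, complete_space} set"
  assumes "closed D" "convex D" "z \<in> D"
  shows "(z - metric_proj D x) \<bullet> (metric_proj D x - x) \<ge> 0"
proof -
  have ne: "D \<noteq> {}" using assms(3) by blast
  have "(x - metric_proj D x) \<bullet> (z - metric_proj D x) \<le> 0"
    using any_closest_point_dot[OF assms(2,1) metric_proj_in[OF assms(1,2) ne] assms(3)]
      metric_proj_nearest[OF assms(1,2) ne] by blast
  then show ?thesis by (simp add: inner_diff_left inner_diff_right inner_commute)
qed

text \<open>
  Turns the variational inequality into a quantitative one: competing points \<open>z\<close> that are almost
  as close to \<open>x\<close> as the projection \<open>p\<close> are close to \<open>p\<close>.
\<close>

lemma obtuse_angle_Pythagoras:
  fixes p x z :: "'a::real_inner"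
  assumes "(z - p) \<bullet> (p - x) \<ge> 0"
  shows "(dist z p)\<^sup>2 + (dist p x)\<^sup>2 \<le> (dist z x)\<^sup>2"
proof -
  have "(dist z x)\<^sup>2 = (dist z p)\<^sup>2 + (dist p x)\<^sup>2 + 2 * ((z - p) \<bullet> (p - x))"
    by (simp add: dist_norm power2_norm_eq_inner algebra_simps inner_commute)
  then show ?thesis using assms by simp
qed

section \<open>Fixed points of pseudo-contractive mappings\<close>

text \<open>
  Writing \<open>T x - T y\<close> as \<open>(x - y) - ((I - T) x - (I - T) y)\<close> and expanding the square, the two
  squares on the right of the definition cancel and only the mixed term is left.
\<close>

lemma pseudo_contractive_on_iff_monotone:
  "pseudo_contractive_on C T \<longleftrightarrow>
     (\<forall>x\<in>C. \<forall>y\<in>C. (x - y) \<bullet> ((x - T x) - (y - T y)) \<ge> 0)"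
proof -
  have "(norm (T x - T y))\<^sup>2 = (norm (x - y))\<^sup>2 + (norm ((x - T x) - (y - T y)))\<^sup>2
          - 2 * ((x - y) \<bullet> ((x - T x) - (y - T y)))" for x y
    by (simp add: power2_norm_eq_inner algebra_simps inner_commute)
  then show ?thesis unfolding pseudo_contractive_on_def by simp
qed

text \<open>
  Monotonicity moves \<open>I - T\<close> from the fixed point \<open>p\<close> to the test point \<open>u\<close>, which leaves a
  condition affine in \<open>p\<close>. Conversely, testing with points \<open>u\<close> that tend to \<open>p\<close> along the segment
  to \<open>T p\<close>, which lies in \<open>C\<close>, gives \<open>- \<parallel>T p - p\<parallel>\<^sup>2 \<ge> 0\<close> in the limit.
\<close>

lemma fixed_points_Minty:
  fixes T :: "'a::real_inner \<Rightarrow> 'a"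
  assumes "convex C" "T \<in> C \<rightarrow> C" "continuous_on C T" "pseudo_contractive_on C T"
  shows "fixed_points C T = {p \<in> C. \<forall>u\<in>C. (u - p) \<bullet> (u - T u) \<ge> 0}"
proof (intro equalityI subsetI)
  fix p assume "p \<in> fixed_points C T"
  then show "p \<in> {p \<in> C. \<forall>u\<in>C. (u - p) \<bullet> (u - T u) \<ge> 0}"
    using assms(4) unfolding pseudo_contractive_on_iff_monotone fixed_points_def by fastforce
next
  fix p assume "p \<in> {p \<in> C. \<forall>u\<in>C. (u - p) \<bullet> (u - T u) \<ge> 0}"
  then have p: "p \<in> C" and weak: "\<And>u. u \<in> C \<Longrightarrow> (u - p) \<bullet> (u - T u) \<ge> 0" by auto
  have "T p \<in> C" using assms(2) p by blast
  define s where "s n = inverse (real (Suc n))" for n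
  define u where "u n = (1 - s n) *\<^sub>R p + s n *\<^sub>R T p" for n
  have s: "s \<longlonglongrightarrow> 0" unfolding s_def by (rule LIMSEQ_inverse_real_of_nat)
  have s01: "0 < s n" "s n \<le> 1" for n unfolding s_def by (auto simp: inverse_le_1_iff)
  have uC: "u n \<in> C" for n
    unfolding u_def using p \<open>T p \<in> C\<close> s01[of n] \<open>convex C\<close> by (intro convexD) auto
  have "u \<longlonglongrightarrow> (1 - 0) *\<^sub>R p + 0 *\<^sub>R T p" unfolding u_def by (intro tendsto_intros s)
  then have u: "u \<longlonglongrightarrow> p" by simp
  have Tu: "(\<lambda>n. T (u n)) \<longlonglongrightarrow> T p"
    using continuous_on_tendsto_compose[OF assms(3) u p] uC by simp
  have "(T p - p) \<bullet> (u n - T (u n)) \<ge> 0" for n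
  proof -
    have "u n - p = s n *\<^sub>R (T p - p)" unfolding u_def by (simp add: algebra_simps)
    then have "s n * ((T p - p) \<bullet> (u n - T (u n))) \<ge> 0" using weak[OF uC[of n]] by simp
    then show ?thesis using s01[of n] by (simp add: zero_le_mult_iff)
  qed
  moreover have "(\<lambda>n. (T p - p) \<bullet> (u n - T (u n))) \<longlonglongrightarrow> (T p - p) \<bullet> (p - T p)"
    by (intro tendsto_intros u Tu)
  ultimately have "(T p - p) \<bullet> (p - T p) \<ge> 0" by (meson LIMSEQ_le_const)
  then have "(T p - p) \<bullet> (T p - p) \<le> 0" by (simp add: inner_diff_right)
  then have "T p - p = 0" using inner_gt_zero_iff[of "T p - p"] by linarith
  then have "T p = p" by simp
  then show "p \<in> fixed_points C T" using p by (simp add: fixed_points_def)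
qed

lemma fixed_points_closed_convex:
  fixes T :: "'a::real_inner \<Rightarrow> 'a"
  assumes "closed C" "convex C" "T \<in> C \<rightarrow> C" "continuous_on C T" "pseudo_contractive_on C T"
  shows "closed (fixed_points C T)" and "convex (fixed_points C T)"
proof -
  have "(u - p) \<bullet> (u - T u) \<ge> 0 \<longleftrightarrow> (u - T u) \<bullet> p \<le> (u - T u) \<bullet> u" for p u
    by (simp add: inner_commute[of "u - p"] inner_diff_right[of _ u p])
  then have "fixed_points C T = C \<inter> (\<Inter>u\<in>C. {p. (u - T u) \<bullet> p \<le> (u - T u) \<bullet> u})"
    unfolding fixed_points_Minty[OF assms(2-5)]
    by auto
  then show "closed (fixed_points C T)" and "convex (fixed_points C T)"
    using assms(1,2)
    by (auto intro!: closed_Int closed_INT convex_Int convex_INT closed_halfspace_le convex_halfspace_le)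
qed

section \<open>Approximate fixed points no farther than the projection\<close>

text \<open>
  A substitute for weak compactness of bounded closed convex sets. The distances from \<open>x\<close> to the
  shrinking sets increase and are bounded, hence converge, and the Pythagorean inequality turns
  their gaps into a Cauchy estimate for the nearest points.
\<close>

lemma decreasing_closed_convex_nearest_points_converge:
  fixes W :: "nat \<Rightarrow> 'a::{real_inner, complete_space} set"
  assumes cl: "\<And>m. closed (W m)" and cv: "\<And>m. convex (W m)" and ne: "\<And>m. W m \<noteq> {}"
    and dec: "decseq W"
    and bound: "\<And>m. dist x (metric_proj (W m) x) \<le> R"
  shows "\<exists>p\<in>\<Inter>m. W m. (\<lambda>m. metric_proj (W m) x) \<longlonglongrightarrow> p"
proof -
  define p where "p m = metric_proj (W m) x" for m
  define r where "r m = (dist (p m) x)\<^sup>2" for m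
  have pW: "p k \<in> W m" if "m \<le> k" for m k
    using metric_proj_in[OF cl cv ne, of k x] decseqD[OF dec that] by (auto simp: p_def)
  have gap: "(dist (p k) (p m))\<^sup>2 + r m \<le> r k" if "m \<le> k" for m k
    unfolding r_def p_def[of m]
    by (intro obtuse_angle_Pythagoras metric_proj_variational cl cv pW that)
  have "incseq r"
  unfolding incseq_def
  proof (intro allI impI)
    fix m n :: nat assume "m \<le> n"
    then show "r m \<le> r n" using gap[of m n] by (smt (verit) zero_le_power2)
  qed
  moreover have "r m \<le> R\<^sup>2" for m
    unfolding r_def using bound[of m] by (simp add: p_def dist_commute power_mono)
  ultimately obtain l where l: "r \<longlonglongrightarrow> l" "\<And>m. r m \<le> l" using incseq_convergent by metis
  have "(\<lambda>m. l - r m) \<longlonglongrightarrow> l - l" by (intro tendsto_intros l)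
  then have s: "(\<lambda>m. l - r m) \<longlonglongrightarrow> 0" by simp
  have "Cauchy p"
  proof (rule Cauchy_if_dist_square_le[OF s])
    fix m k :: nat assume "m \<le> k"
    then show "(dist (p m) (p k))\<^sup>2 \<le> (l - r m) + (l - r k)"
      using gap[of m k] l(2)[of k] by (simp add: dist_commute)
  qed
  then obtain q where q: "p \<longlonglongrightarrow> q" by (meson Cauchy_convergent convergent_def)
  have "q \<in> W m" for m
  proof (rule Lim_in_closed_set[OF cl _ sequentially_bot q])
    show "\<forall>\<^sub>F k in sequentially. p k \<in> W m"
      using eventually_ge_at_top[of m] by eventually_elim (rule pW)
  qed
  then show ?thesis using q by (auto simp: p_def[abs_def])
qed

text \<open>
  This plays the part of the demiclosedness of \<open>I - T\<close> at \<open>0\<close> together with the Kadec-Klee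
  property. For fixed \<open>u\<close>, monotonicity puts \<open>x n\<close> in the half-space given by Minty's inequality
  up to an error that tends to \<open>0\<close>, so each point common to all tail hulls is a fixed point. By
  the distance bound the common point found as a limit can only be the projection of \<open>v\<close>.
  Finally the Pythagorean inequality in the tail hulls squeezes \<open>x m\<close> and the nearest point of its
  tail hull together, since the distance from \<open>v\<close> to this nearest point tends to the upper bound
  for the distance from \<open>v\<close> to \<open>x m\<close>.
\<close>

lemma approximate_fixed_points_tendsto_proj:
  fixes T :: "'a::{real_inner, complete_space} \<Rightarrow> 'a" and x :: "nat \<Rightarrow> 'a"
  assumes "closed C" "convex C" "T \<in> C \<rightarrow> C" "continuous_on C T" "pseudo_contractive_on C T"
    and ne: "fixed_points C T \<noteq> {}"
    and xC: "\<And>n. x n \<in> C"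
    and approx: "(\<lambda>n. norm (x n - T (x n))) \<longlonglongrightarrow> 0"
    and near: "\<And>n. dist v (x n) \<le> dist v (metric_proj (fixed_points C T) v)"
  shows "x \<longlonglongrightarrow> metric_proj (fixed_points C T) v"
proof -
  define F where "F = fixed_points C T"
  define q where "q = metric_proj F v"
  have F: "closed F" "convex F" "F \<noteq> {}"
    using fixed_points_closed_convex[OF assms(1-5)] ne by (auto simp: F_def)
  have near': "dist v (x n) \<le> dist v q" for n using near by (simp add: q_def F_def)
  define W where "W m = closure (convex hull (x ` {m..}))" for m
  have Wcl: "closed (W m)" and Wcv: "convex (W m)" for m
    by (auto simp: W_def intro: convex_closure)
  have xW: "x n \<in> W m" if "m \<le> n" for m n
    using that hull_subset[of "x ` {m..}" convex] closure_subset[of "convex hull (x ` {m..})"]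
    by (auto simp: W_def)
  have Wne: "W m \<noteq> {}" for m using xW[of m m] by auto
  have Wdec: "decseq W"
    unfolding W_def decseq_def by (auto intro!: closure_mono hull_mono image_mono)
  have Wmin: "W m \<subseteq> S" if "closed S" "convex S" "\<And>n. n \<ge> m \<Longrightarrow> x n \<in> S" for m S
    unfolding W_def using that by (intro closure_minimal hull_minimal) auto
  define p where "p m = metric_proj (W m) v" for m
  have pnear: "dist v (p m) \<le> dist v (x m)" for m
    unfolding p_def by (intro metric_proj_nearest Wcl Wcv Wne xW) simp
  have "\<exists>p'\<in>\<Inter>m. W m. p \<longlonglongrightarrow> p'"
    unfolding p_def[abs_def]
  proof (rule decreasing_closed_convex_nearest_points_converge[OF Wcl Wcv Wne Wdec])
    show "dist v (metric_proj (W m) v) \<le> dist v q" for m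
      using pnear[of m] near'[of m] by (simp add: p_def)
  qed
  then obtain p' where p': "\<And>m. p' \<in> W m" and lim: "p \<longlonglongrightarrow> p'" by auto
  have "p' \<in> C" using Wmin[OF assms(1,2), of 0] xC p' by blast
  have "(u - p') \<bullet> (u - T u) \<ge> 0" if u: "u \<in> C" for u
  proof -
    (* a bound for the distance from u to every x n *)
    define B where "B = dist u v + dist v q"
    have lower: "(u - x n) \<bullet> (u - T u) \<ge> - (B * norm (x n - T (x n)))" for n
    proof -
      have "dist u (x n) \<le> B"
        using dist_triangle[of u "x n" v] near'[of n] by (simp add: B_def)
      then have "norm (u - x n) * norm (x n - T (x n)) \<le> B * norm (x n - T (x n))"
        by (intro mult_right_mono) (auto simp: dist_norm)
      moreover have "\<bar>(u - x n) \<bullet> (x n - T (x n))\<bar> \<le> norm (u - x n) * norm (x n - T (x n))"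
        by (rule Cauchy_Schwarz_ineq2)
      moreover have "(u - x n) \<bullet> ((u - T u) - (x n - T (x n))) \<ge> 0"
        using assms(5) u xC unfolding pseudo_contractive_on_iff_monotone by blast
      ultimately show ?thesis by (simp add: inner_diff_right[of "u - x n" "u - T u"])
    qed
    have "(\<lambda>n. - (B * norm (x n - T (x n)))) \<longlonglongrightarrow> - (B * 0)" by (intro tendsto_intros approx)
    then have to0: "(\<lambda>n. - (B * norm (x n - T (x n)))) \<longlonglongrightarrow> 0" by simp
    have "- e \<le> (u - p') \<bullet> (u - T u)" if "e > 0" for e
    proof -
      have "\<forall>\<^sub>F n in sequentially. - (B * norm (x n - T (x n))) > - e"
        using order_tendstoD(1)[OF to0, of "- e"] that by simp
      then obtain N where N: "\<And>n. n \<ge> N \<Longrightarrow> - (B * norm (x n - T (x n))) > - e"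
        unfolding eventually_sequentially by blast
      (* a half-space containing a tail contains its closed convex hull, hence p' *)
      have "W N \<subseteq> {w. (u - T u) \<bullet> w \<le> (u - T u) \<bullet> u + e}"
      proof (rule Wmin[OF closed_halfspace_le convex_halfspace_le])
        fix n assume "n \<ge> N"
        then have "- e \<le> (u - x n) \<bullet> (u - T u)" using lower[of n] N[of n] by linarith
        then show "x n \<in> {w. (u - T u) \<bullet> w \<le> (u - T u) \<bullet> u + e}"
          by (simp add: inner_commute[of "u - x n"] inner_diff_right[of _ u "x n"])
      qed
      then have "(u - T u) \<bullet> p' \<le> (u - T u) \<bullet> u + e" using p'[of N] by blast
      then show ?thesis by (simp add: inner_commute[of "u - p'"] inner_diff_right[of _ u p'])
    qed
    then have "0 \<le> (u - p') \<bullet> (u - T u) + e" if "e > 0" for e using that by fastforce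
    then show ?thesis by (rule field_le_epsilon)
  qed
  then have "p' \<in> F" unfolding F_def fixed_points_Minty[OF assms(2-5)] using \<open>p' \<in> C\<close> by blast
  have dist_lim: "(\<lambda>m. dist v (p m)) \<longlonglongrightarrow> dist v p'" by (intro tendsto_intros lim)
  have "dist v p' \<le> dist v q"
    using LIMSEQ_le_const2[OF dist_lim] pnear near' order_trans by meson
  then have "(dist p' v)\<^sup>2 \<le> (dist q v)\<^sup>2" by (simp add: dist_commute power_mono)
  moreover have "(dist p' q)\<^sup>2 + (dist q v)\<^sup>2 \<le> (dist p' v)\<^sup>2"
    unfolding q_def
    by (intro obtuse_angle_Pythagoras metric_proj_variational F \<open>p' \<in> F\<close>)
  ultimately have "(dist p' q)\<^sup>2 \<le> 0" by linarith
  then have "p' = q" by simp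
  have gap: "(dist (x m) (p m))\<^sup>2 \<le> (dist v q)\<^sup>2 - (dist v (p m))\<^sup>2" for m
  proof -
    have "(dist (x m) (p m))\<^sup>2 + (dist (p m) v)\<^sup>2 \<le> (dist (x m) v)\<^sup>2"
      unfolding p_def
      by (intro obtuse_angle_Pythagoras metric_proj_variational Wcl Wcv xW) simp
    moreover have "(dist (x m) v)\<^sup>2 \<le> (dist v q)\<^sup>2"
      using near'[of m] by (simp add: dist_commute power_mono)
    ultimately show ?thesis unfolding dist_commute[of "p m" v] by linarith
  qed
  have "(\<lambda>m. (dist v q)\<^sup>2 - (dist v (p m))\<^sup>2) \<longlonglongrightarrow> (dist v q)\<^sup>2 - (dist v q)\<^sup>2"
    using lim unfolding \<open>p' = q\<close> by (intro tendsto_intros)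
  then have "(\<lambda>m. (dist v q)\<^sup>2 - (dist v (p m))\<^sup>2) \<longlonglongrightarrow> 0" by simp
  then have "(\<lambda>m. (dist (x m) (p m))\<^sup>2) \<longlonglongrightarrow> 0"
    by (rule Lim_null_comparison[rotated]) (simp add: gap)
  then have "(\<lambda>m. sqrt ((dist (x m) (p m))\<^sup>2)) \<longlonglongrightarrow> sqrt 0" by (rule tendsto_real_sqrt)
  then have "(\<lambda>m. dist (x m) (p m)) \<longlonglongrightarrow> 0" by simp
  then have "(\<lambda>m. x m - p m) \<longlonglongrightarrow> 0"
    by (simp add: dist_norm tendsto_norm_zero_iff)
  from tendsto_add[OF this lim] show ?thesis by (simp add: \<open>p' = q\<close> q_def F_def)
qed

section \<open>The hybrid projection method\<close>

text \<open>
  The hypothesis says that \<open>x n\<close> is nearest to \<open>v\<close> in a half-space that contains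
  \<open>x (Suc n)\<close>. So the squared distances to \<open>v\<close> grow by at least the squared step length, and
  being bounded they leave no room for steps that do not tend to \<open>0\<close>.
\<close>

lemma outer_projections_asymptotically_regular:
  fixes x :: "nat \<Rightarrow> 'a::real_inner"
  assumes step: "\<And>n. (x (Suc n) - x n) \<bullet> (x n - v) \<ge> 0"
    and bound: "\<And>n. dist v (x n) \<le> R"
  shows "(\<lambda>n. dist (x n) (x (Suc n))) \<longlonglongrightarrow> 0"
proof -
  define r where "r n = (dist v (x n))\<^sup>2" for n
  have gap: "(dist (x n) (x (Suc n)))\<^sup>2 \<le> r (Suc n) - r n" for n
    using obtuse_angle_Pythagoras[OF step[of n]] by (simp add: r_def dist_commute)
  have "incseq r"
    unfolding incseq_Suc_iff using gap by (smt (verit) zero_le_power2)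
  moreover have "r n \<le> R\<^sup>2" for n unfolding r_def using bound[of n] by (simp add: power_mono)
  ultimately obtain l where l: "r \<longlonglongrightarrow> l" using incseq_convergent by metis
  have "(\<lambda>n. r (Suc n) - r n) \<longlonglongrightarrow> l - l" by (intro tendsto_intros LIMSEQ_Suc l)
  then have "(\<lambda>n. r (Suc n) - r n) \<longlonglongrightarrow> 0" by simp
  then have "(\<lambda>n. (dist (x n) (x (Suc n)))\<^sup>2) \<longlonglongrightarrow> 0"
    by (rule Lim_null_comparison[rotated]) (simp add: gap)
  then have "(\<lambda>n. sqrt ((dist (x n) (x (Suc n)))\<^sup>2)) \<longlonglongrightarrow> sqrt 0" by (rule tendsto_real_sqrt)
  then show ?thesis by simp
qed

text \<open>
  The cut defining \<open>C\<^sub>n\<close> lies a distance proportional to the residual \<open>\<parallel>w\<parallel>\<close> away from the current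
  iterate; a point \<open>z\<close> beyond it is therefore at least that far from \<open>x\<close>.
\<close>

lemma residual_le_step_in_halfspace:
  fixes w :: "'a::real_inner"
  assumes "t > 0" "\<alpha> > 0"
    and "t * (norm (\<alpha> *\<^sub>R w))\<^sup>2 \<le> 2 * \<alpha> * ((x - z) \<bullet> w)"
  shows "t * \<alpha> * norm w \<le> 2 * dist x z"
proof (cases "w = 0")
  case False
  have "(\<alpha> * norm w) * (t * \<alpha> * norm w) = t * (norm (\<alpha> *\<^sub>R w))\<^sup>2"
    using \<open>\<alpha> > 0\<close> by (simp add: power2_eq_square)
  also have "\<dots> \<le> 2 * \<alpha> * (norm (x - z) * norm w)"
    using assms(3) mult_left_mono[OF norm_cauchy_schwarz[of "x - z" w], of "2 * \<alpha>"] \<open>\<alpha> > 0\<close>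
    by linarith
  also have "\<dots> = (\<alpha> * norm w) * (2 * dist x z)" by (simp add: dist_norm)
  finally show ?thesis using False \<open>\<alpha> > 0\<close> by simp
qed (simp add: dist_norm)

text \<open>
  The relaxed point \<open>y\<close> differs from \<open>u\<close> by \<open>\<alpha>\<close> times the residual at \<open>u\<close>, so replacing \<open>u\<close> by \<open>y\<close>
  costs \<open>\<alpha>\<close> times the residual for the point itself and \<open>L \<alpha>\<close> times for its image. The bound is
  useful when \<open>(L + 1) \<alpha> < 1\<close>.
\<close>

lemma residual_le_residual_at_relaxed_point:
  fixes T :: "'a::real_normed_vector \<Rightarrow> 'a"
  assumes "L-lipschitz_on C T" "u \<in> C" "y \<in> C" "0 \<le> \<alpha>" "y = (1 - \<alpha>) *\<^sub>R u + \<alpha> *\<^sub>R T u"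
  shows "(1 - (L + 1) * \<alpha>) * norm (u - T u) \<le> norm (y - T y)"
proof -
  have "u - y = \<alpha> *\<^sub>R (u - T u)" unfolding assms(5) by (simp add: algebra_simps)
  then have uy: "norm (u - y) = \<alpha> * norm (u - T u)" using \<open>0 \<le> \<alpha>\<close> by simp
  have "norm (T y - T u) \<le> L * norm (u - y)"
    using lipschitz_onD[OF assms(1,3,2)] by (simp add: dist_norm norm_minus_commute)
  moreover have "u - T u = (u - y) + (y - T y) + (T y - T u)" by simp
  then have "norm (u - T u) \<le> norm (u - y) + norm (y - T y) + norm (T y - T u)"
    by (metis norm_triangle_le norm_triangle_ineq add_right_mono order_trans)
  ultimately show ?thesis unfolding uy by (simp add: algebra_simps)
qed

theorem theorem5p2:
  fixes C :: "'a::{real_inner, complete_space} set"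
    and T :: "'a \<Rightarrow> 'a"
    and L \<tau>\<^sub>0 a b :: real
    and \<tau> \<alpha> :: "nat \<Rightarrow> real"
    and x y :: "nat \<Rightarrow> 'a"
    and Cn Qn Cstar :: "nat \<Rightarrow> 'a set"
  assumes "C \<noteq> {}" and "closed C" and "convex C"
    and "T \<in> C \<rightarrow> C"
    and "L-lipschitz_on C T" and "L \<ge> 1"
    and "pseudo_contractive_on C T"
    and "fixed_points C T \<noteq> {}"
    and "\<tau>\<^sub>0 \<in> {0<..1}" and "\<And>n. \<tau> n \<in> {\<tau>\<^sub>0..1}"
    and "a \<in> {0<..<1 / (L + 1)}" and "b \<in> {0<..<1 / (L + 1)}"
    and "\<And>n. \<alpha> n \<in> {a..b}"
    and "x 0 \<in> C"
    and "\<And>n. y n = (1 - \<alpha> n) *\<^sub>R x n + \<alpha> n *\<^sub>R T (x n)"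
    and "\<And>n. Cn n = {z \<in> C. \<tau> n * (norm (\<alpha> n *\<^sub>R (y n - T (y n))))\<^sup>2
                              \<le> 2 * \<alpha> n * ((x n - z) \<bullet> (y n - T (y n)))}"
    and "\<And>n. Qn n = {z \<in> C. (z - x n) \<bullet> (x n - x 0) \<ge> 0}"
    and "\<And>n. closed (Cstar n)" and "\<And>n. convex (Cstar n)"
    and "\<And>n. fixed_points C T \<subseteq> Cstar n" and "\<And>n. Cstar n \<subseteq> Cn n"
    and "\<And>n. x (Suc n) = metric_proj (Cstar n \<inter> Qn n) (x 0)"
  shows "x \<longlonglongrightarrow> metric_proj (fixed_points C T) (x 0)"
proof -
  define F where "F = fixed_points C T"
  define q where "q = metric_proj F (x 0)"
  have cont: "continuous_on C T" using assms(5) by (rule lipschitz_on_continuous_on)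
  have FC: "F \<subseteq> C" by (auto simp: F_def fixed_points_def)
  have F: "closed F" "convex F" "F \<noteq> {}"
    using fixed_points_closed_convex[OF assms(2-4) cont assms(7)] assms(8) by (auto simp: F_def)
  have qF: "q \<in> F" unfolding q_def by (rule metric_proj_in[OF F])
  have Q_halfspace: "Qn n = C \<inter> {z. (x n - x 0) \<bullet> z \<ge> (x n - x 0) \<bullet> x n}" for n
    unfolding assms(17) by (auto simp: inner_diff_left inner_diff_right inner_commute)
  have D: "closed (Cstar n \<inter> Qn n)" "convex (Cstar n \<inter> Qn n)" for n
    unfolding Q_halfspace using assms(2,3,18,19)
    by (auto intro!: closed_Int convex_Int closed_halfspace_ge convex_halfspace_ge)
  (* The variational inequality at the projection x (Suc n) is the membership condition of
     Qn (Suc n); the hypothesis on step n makes it applicable to all of F. *)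
  have FQ: "F \<subseteq> Qn n" for n
  proof (induction n)
    case 0
    show ?case using FC by (auto simp: assms(17))
  next
    case (Suc n)
    have "(z - x (Suc n)) \<bullet> (x (Suc n) - x 0) \<ge> 0" if "z \<in> F" for z
      unfolding assms(22)
      by (rule metric_proj_variational[OF D]) (use that Suc assms(20) in \<open>auto simp: F_def\<close>)
    then show ?case using FC by (auto simp: assms(17))
  qed
  have FD: "F \<subseteq> Cstar n \<inter> Qn n" for n using FQ[of n] assms(20)[of n] by (auto simp: F_def)
  have xSuc: "x (Suc n) \<in> Cstar n \<inter> Qn n" for n
    unfolding assms(22) by (rule metric_proj_in[OF D]) (use FD[of n] F(3) in blast)
  have xC: "x n \<in> C" for n
    using assms(14) xSuc by (cases n) (auto simp: Q_halfspace)
  have near: "dist (x 0) (x n) \<le> dist (x 0) q" for n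
  proof (cases n)
    case (Suc k)
    show ?thesis unfolding Suc assms(22)
      by (rule metric_proj_nearest[OF D]) (use FD[of k] qF in blast)+
  qed simp
  have steps: "(\<lambda>n. dist (x n) (x (Suc n))) \<longlonglongrightarrow> 0"
  proof (rule outer_projections_asymptotically_regular[OF _ near])
    show "(x (Suc n) - x n) \<bullet> (x n - x 0) \<ge> 0" for n using xSuc[of n] by (simp add: assms(17))
  qed
  have pos: "\<tau>\<^sub>0 > 0" "a > 0" "L + 1 > 0" using assms(6,9,11) by auto
  (* a lower bound for the factors 1 - (L + 1) * \<alpha> n, uniform in n *)
  define \<kappa> where "\<kappa> = 1 - (L + 1) * b"
  have "\<kappa> > 0" using assms(12) pos(3) by (simp add: \<kappa>_def field_simps)
  have residual: "norm (x n - T (x n)) \<le> 2 / (\<kappa> * (\<tau>\<^sub>0 * a)) * dist (x n) (x (Suc n))" for n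
  proof -
    have \<alpha>: "a \<le> \<alpha> n" "\<alpha> n \<le> b" using assms(13)[of n] by auto
    have \<tau>: "\<tau>\<^sub>0 \<le> \<tau> n" using assms(10)[of n] by auto
    have "1 / (L + 1) \<le> 1" using assms(6) by simp
    then have "\<alpha> n \<le> 1" using \<alpha> assms(12) by (auto simp del: divide_le_eq_1)
    have yC: "y n \<in> C"
      unfolding assms(15) using \<open>\<alpha> n \<le> 1\<close> \<alpha> pos xC[of n] assms(3,4)
      by (intro convexD) auto
    have "\<kappa> \<le> 1 - (L + 1) * \<alpha> n" using \<alpha>(2) pos(3) by (simp add: \<kappa>_def)
    then have "\<kappa> * norm (x n - T (x n)) \<le> (1 - (L + 1) * \<alpha> n) * norm (x n - T (x n))"
      by (rule mult_right_mono) simp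
    also have "\<dots> \<le> norm (y n - T (y n))"
      using residual_le_residual_at_relaxed_point[OF assms(5) xC yC _ assms(15)] \<alpha> pos by simp
    finally have "\<kappa> * norm (x n - T (x n)) \<le> norm (y n - T (y n))" .
    then have "(\<tau>\<^sub>0 * a) * (\<kappa> * norm (x n - T (x n))) \<le> (\<tau> n * \<alpha> n) * norm (y n - T (y n))"
      using \<alpha> \<tau> pos \<open>\<kappa> > 0\<close> by (intro mult_mono) auto
    also have "\<dots> \<le> 2 * dist (x n) (x (Suc n))"
    proof (rule residual_le_step_in_halfspace)
      show "\<tau> n * (norm (\<alpha> n *\<^sub>R (y n - T (y n))))\<^sup>2
              \<le> 2 * \<alpha> n * ((x n - x (Suc n)) \<bullet> (y n - T (y n)))"
        using xSuc[of n] assms(21)[of n] unfolding assms(16) by blast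
    qed (use \<alpha> \<tau> pos in auto)
    finally show ?thesis using pos \<open>\<kappa> > 0\<close> by (simp add: field_simps)
  qed
  have "(\<lambda>n. 2 / (\<kappa> * (\<tau>\<^sub>0 * a)) * dist (x n) (x (Suc n))) \<longlonglongrightarrow> 2 / (\<kappa> * (\<tau>\<^sub>0 * a)) * 0"
    by (intro tendsto_intros steps)
  then have "(\<lambda>n. 2 / (\<kappa> * (\<tau>\<^sub>0 * a)) * dist (x n) (x (Suc n))) \<longlonglongrightarrow> 0" by simp
  then have "(\<lambda>n. norm (x n - T (x n))) \<longlonglongrightarrow> 0"
    by (rule Lim_null_comparison[rotated]) (simp add: residual del: times_divide_eq_left)
  then show ?thesis
    by (rule approximate_fixed_points_tendsto_proj[OF assms(2-4) cont assms(7,8) xC])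
      (use near in \<open>simp add: q_def F_def\<close>)
qed

end
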